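(* Let $L=\{l_n\}_{n\ge1}$ and $M=\{m_n\}_{n\ge1}$ be increasing sequences (finite or infinite) of positive even integers, and let $Z=\{z_n\}_{n\ge1}=L\cap M$ be the increasing sequence of their common terms. Let $L(y)=\#\{n:l_n\le y\}$, $M(y)=\#\{n:m_n\le y\}$, $Z(y)=\#\{n:z_n\le y\}$ be the counting functions. For a nonnegative even integer $x$, let $e(x)$ be the number of solutions of $x=l+m$ with $l\in L$, $m\in M$, where the order of the summands is not important; that is, $e(x)$ is the number of pairs $(a,b)$ with $a\le b$, $a+b=x$, such that ($a\in L$ and $b\in M$) or ($a\in M$ and $b\in L$). Then for every even $x\ge2$, $$e(x)=\sum_{m\in M,\ m\le x/2}L(x-m)+\sum_{l\in L,\ l\le x/2}M(x-l)-\sum_{z\in Z,\ z\le x/2}Z(x-z)-L(x/2)\,M(x/2)+\binom{Z(x/2)+1}{2}-e(x-2)-e(x-4)-\dots-e(0).$$ *)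

theory Defs
  imports Complex_Main "HOL-Library.Extended_Nat"
begin

text \<open>
  A finite or infinite sequence \<open>a\<^sub>1, a\<^sub>2, \<dots>\<close> is a function on \<open>nat\<close> together with a length
  \<open>N :: enat\<close>; only the values at the indices \<open>1 \<le> n \<le> N\<close> are relevant.
  Length \<open>0\<close> is permitted, since two such sequences may have no common term.
\<close>

definition seq_indices :: "enat \<Rightarrow> nat set" where
  "seq_indices N = {n. 1 \<le> n \<and> enat n \<le> N}"

definition increasing_seq :: "enat \<Rightarrow> (nat \<Rightarrow> nat) \<Rightarrow> bool" where
  "increasing_seq N a \<longleftrightarrow> strict_mono_on (seq_indices N) a"

definition seq_terms :: "enat \<Rightarrow> (nat \<Rightarrow> nat) \<Rightarrow> nat set" where
  "seq_terms N a = a ` seq_indices N"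

definition seq_count :: "enat \<Rightarrow> (nat \<Rightarrow> nat) \<Rightarrow> real \<Rightarrow> nat" where
  "seq_count N a y = card {n \<in> seq_indices N. real (a n) \<le> y}"

definition num_repr :: "nat set \<Rightarrow> nat set \<Rightarrow> nat \<Rightarrow> nat" where
  "num_repr A B x =
     card {(a, b). a \<le> b \<and> a + b = x \<and> (a \<in> A \<and> b \<in> B \<or> a \<in> B \<and> b \<in> A)}"

end

theory Submission
  imports Defs
begin

text \<open>
  Moving the subtracted values of \<open>e\<close> to the left turns the claim into a formula for the number of
  unordered pairs with sum at most \<open>x\<close>. The smaller element of such a pair is at most \<open>x/2\<close>, and the
  first two sums count the pairs by this element, but they also count the pairs with second element
  \<open>b\<close> smaller than the first element \<open>a \<le> x/2\<close>, of which there are \<open>L(x/2) M(x/2) - Z(x/2)\<close>. Pairs of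
  common terms are counted twice. The sum over \<open>Z\<close> removes one copy of each, and in addition one for
  each of the \<open>Z(x/2)\<close> choose 2 pairs \<open>b < a \<le> x/2\<close> in \<open>Z\<close>; together with the \<open>Z(x/2)\<close> above, these
  make up the binomial coefficient.
\<close>

definition ordered_pairs :: "nat set \<Rightarrow> nat set \<Rightarrow> nat \<Rightarrow> (nat \<times> nat) set" where
  "ordered_pairs A B x = {(a, b). a \<in> A \<and> b \<in> B \<and> a \<le> b \<and> a + b \<le> x}"

text \<open>No bound on the sum is imposed: in the application both sets are cut off at
  \<open>x/2\<close>, so any two of their elements have sum at most \<open>x\<close>.\<close>

definition descents :: "nat set \<Rightarrow> nat set \<Rightarrow> (nat \<times> nat) set" where
  "descents A B = {(a, b). a \<in> A \<and> b \<in> B \<and> b < a}"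

text \<open>A strictly increasing sequence is injective, so counting indices is counting terms. From
  here on only the sets of terms matter.\<close>

lemma seq_count_eq_card:
  assumes "increasing_seq N a"
  shows "seq_count N a y = card {t \<in> seq_terms N a. real t \<le> y}"
proof -
  have "inj_on a (seq_indices N)"
    using assms strict_mono_on_imp_inj_on unfolding increasing_seq_def by blast
  then have "inj_on a {n \<in> seq_indices N. real (a n) \<le> y}"
    by (rule inj_on_subset) auto
  moreover have "{t \<in> seq_terms N a. real t \<le> y} = a ` {n \<in> seq_indices N. real (a n) \<le> y}"
    by (auto simp: seq_terms_def)
  ultimately show ?thesis
    by (simp add: seq_count_def card_image)
qed

lemma finite_ordered_pairs: "finite (ordered_pairs A B x)"
  by (rule finite_subset[of _ "{..x} \<times> {..x}"]) (auto simp: ordered_pairs_def)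

lemma finite_descents:
  assumes "finite A"
  shows "finite (descents A B)"
proof (rule finite_subset)
  show "descents A B \<subseteq> Sigma A (\<lambda>a. {..<a})"
    by (auto simp: descents_def)
qed (use assms in auto)

text \<open>The sum counts pairs with \<open>2 * a \<le> x\<close> and \<open>a + b \<le> x\<close>;
  split them by whether \<open>a \<le> b\<close>. If so, \<open>2 * a \<le> x\<close> follows from
  the bound on the sum. Otherwise \<open>b < a\<close> gives \<open>2 * b \<le> x\<close>, and the
  bound on the sum is automatic.\<close>

lemma sum_card_eq:
  fixes A B :: "nat set"
  shows "(\<Sum>a \<in> {a \<in> A. 2 * a \<le> x}. card {b \<in> B. a + b \<le> x}) =
    card (ordered_pairs A B x) + card (descents {a \<in> A. 2 * a \<le> x} {b \<in> B. 2 * b \<le> x})"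
proof -
  have fin: "finite {a \<in> A. 2 * a \<le> x}"
    by (rule finite_subset[of _ "{..x}"]) auto
  have "(\<Sum>a \<in> {a \<in> A. 2 * a \<le> x}. card {b \<in> B. a + b \<le> x}) =
      card (Sigma {a \<in> A. 2 * a \<le> x} (\<lambda>a. {b \<in> B. a + b \<le> x}))"
    using fin by (subst card_SigmaI) (auto intro: finite_subset[of _ "{..x}"])
  also have "Sigma {a \<in> A. 2 * a \<le> x} (\<lambda>a. {b \<in> B. a + b \<le> x}) =
      ordered_pairs A B x \<union> descents {a \<in> A. 2 * a \<le> x} {b \<in> B. 2 * b \<le> x}"
    by (auto simp: ordered_pairs_def descents_def)
  also have "card \<dots> =
      card (ordered_pairs A B x) + card (descents {a \<in> A. 2 * a \<le> x} {b \<in> B. 2 * b \<le> x})"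
    using fin
    by (intro card_Un_disjoint finite_ordered_pairs finite_descents)
      (auto simp: ordered_pairs_def descents_def)
  finally show ?thesis .
qed

text \<open>Trichotomy splits \<open>A \<times> B\<close> into the pairs with \<open>b < a\<close>,
  those with \<open>a < b\<close> (swapped descents of \<open>B\<close> and \<open>A\<close>) and
  the diagonal over \<open>A \<inter> B\<close>.\<close>

lemma card_descents_add:
  assumes "finite A" "finite B"
  shows "card (descents A B) + card (descents B A) + card (A \<inter> B) = card A * card B"
proof -
  have "A \<times> B = (descents A B \<union> prod.swap ` descents B A) \<union> (\<lambda>c. (c, c)) ` (A \<inter> B)"
    by (auto simp: descents_def image_iff)
  then have "card A * card B =
      card ((descents A B \<union> prod.swap ` descents B A) \<union> (\<lambda>c. (c, c)) ` (A \<inter> B))"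
    by (metis card_cartesian_product)
  also have "\<dots> = card (descents A B \<union> prod.swap ` descents B A) + card ((\<lambda>c. (c, c)) ` (A \<inter> B))"
    using assms by (intro card_Un_disjoint finite_UnI finite_imageI finite_Int finite_descents)
      (auto simp: descents_def)
  also have "card (descents A B \<union> prod.swap ` descents B A) =
      card (descents A B) + card (prod.swap ` descents B A)"
    using assms by (intro card_Un_disjoint finite_UnI finite_imageI finite_Int finite_descents)
      (auto simp: descents_def)
  finally show ?thesis
    using card_image[OF inj_on_subset[OF inj_swap subset_UNIV], of "descents B A"]
    by (simp add: card_image inj_on_def)
qed

lemma card_descents_self:
  assumes "finite C"
  shows "card (descents C C) + card C = (card C + 1) choose 2"
proof -
  have "2 * (n + 1 choose 2) = n * n + n" for n :: nat
    by (induction n) (auto simp: numeral_2_eq_2)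
  \<comment> \<open>With both sets equal to \<open>C\<close>, the trichotomy count says that twice
    the number of descents plus \<open>card C\<close> is the square of
    \<open>card C\<close>.\<close>
  from this[of "card C"] card_descents_add[OF assms assms] show ?thesis
    by simp
qed

text \<open>Group the pairs by their sum: by parity, every sum that occurs has the form
  \<open>x - 2 * i\<close>.\<close>

lemma sum_num_repr:
  assumes "\<forall>a \<in> A. even a" "\<forall>b \<in> B. even b" "even x"
  shows "(\<Sum>i = 0..x div 2. num_repr A B (x - 2 * i)) =
    card (ordered_pairs A B x \<union> ordered_pairs B A x)"
proof -
  let ?R = "\<lambda>y. {(a, b). a \<le> b \<and> a + b = y \<and> (a \<in> A \<and> b \<in> B \<or> a \<in> B \<and> b \<in> A)}"
  have fin: "finite (?R y)" for y
    by (rule finite_subset[of _ "{..y} \<times> {..y}"]) auto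
  have "(\<Sum>i = 0..x div 2. num_repr A B (x - 2 * i)) = card (\<Union>i \<in> {0..x div 2}. ?R (x - 2 * i))"
    \<comment> \<open>Since \<open>i \<le> x div 2\<close>, the subtraction is not truncated, so
      distinct \<open>i\<close> give distinct sums and hence disjoint sets.\<close>
    unfolding num_repr_def using fin by (subst card_UN_disjoint) auto
  also have "(\<Union>i \<in> {0..x div 2}. ?R (x - 2 * i)) = ordered_pairs A B x \<union> ordered_pairs B A x"
    (is "?U = ?V")
  proof
    show "?U \<subseteq> ?V"
      by (auto simp: ordered_pairs_def)
    show "?V \<subseteq> ?U"
    proof
      fix p assume p: "p \<in> ?V"
      obtain a b where ab: "p = (a, b)" by fastforce
      have le: "a + b \<le> x" and "even (a + b)"
        using p ab assms(1,2) by (auto simp: ordered_pairs_def)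
      with assms(3) have "x - 2 * ((x - (a + b)) div 2) = a + b"
        by simp
      with p ab have "p \<in> ?R (x - 2 * ((x - (a + b)) div 2))"
        by (auto simp: ordered_pairs_def)
      moreover have "(x - (a + b)) div 2 \<in> {0..x div 2}"
        by (simp add: div_le_mono)
      ultimately show "p \<in> ?U" by blast
    qed
  qed
  finally show ?thesis .
qed

theorem theorem2:
  fixes l m z :: "nat \<Rightarrow> nat" and N\<^sub>l N\<^sub>m N\<^sub>z :: enat and x :: nat
  assumes "increasing_seq N\<^sub>l l" and "\<forall>a \<in> seq_terms N\<^sub>l l. 0 < a \<and> even a"
    and "increasing_seq N\<^sub>m m" and "\<forall>a \<in> seq_terms N\<^sub>m m. 0 < a \<and> even a"
    and "increasing_seq N\<^sub>z z" and "seq_terms N\<^sub>z z = seq_terms N\<^sub>l l \<inter> seq_terms N\<^sub>m m"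
    and "even x" and "2 \<le> x"
  shows "int (num_repr (seq_terms N\<^sub>l l) (seq_terms N\<^sub>m m) x) =
      (\<Sum>b \<in> {b \<in> seq_terms N\<^sub>m m. real b \<le> real x / 2}. int (seq_count N\<^sub>l l (real x - real b)))
    + (\<Sum>a \<in> {a \<in> seq_terms N\<^sub>l l. real a \<le> real x / 2}. int (seq_count N\<^sub>m m (real x - real a)))
    - (\<Sum>c \<in> {c \<in> seq_terms N\<^sub>z z. real c \<le> real x / 2}. int (seq_count N\<^sub>z z (real x - real c)))
    - int (seq_count N\<^sub>l l (real x / 2)) * int (seq_count N\<^sub>m m (real x / 2))
    + int ((seq_count N\<^sub>z z (real x / 2) + 1) choose 2)
    - (\<Sum>i = 1..x div 2. int (num_repr (seq_terms N\<^sub>l l) (seq_terms N\<^sub>m m) (x - 2 * i)))"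
proof -
  define A B where "A = seq_terms N\<^sub>l l" and "B = seq_terms N\<^sub>m m"
  define H where "H S = {a \<in> S. 2 * a \<le> x}" for S :: "nat set"
  define D where "D S T = (\<Sum>a \<in> H S. card {b \<in> T. a + b \<le> x})" for S T :: "nat set"
  have C: "seq_terms N\<^sub>z z = A \<inter> B"
    using assms(6) by (simp add: A_def B_def)
  have half: "real a \<le> real x / 2 \<longleftrightarrow> 2 * a \<le> x" for a
    by linarith
  have diff: "real b \<le> real x - real a \<longleftrightarrow> a + b \<le> x" for a b
    by linarith
  have fin: "finite (H S)" for S
    by (rule finite_subset[of _ "{..x}"]) (auto simp: H_def)
  have D: "D S T = card (ordered_pairs S T x) + card (descents (H S) (H T))" for S T
    unfolding D_def H_def by (rule sum_card_eq)
  have HC: "H (A \<inter> B) = H A \<inter> H B"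
    by (auto simp: H_def)
  \<comment> \<open>The pairs that are counted twice are those with both elements common to
    \<open>A\<close> and \<open>B\<close>.\<close>
  have "ordered_pairs A B x \<inter> ordered_pairs B A x = ordered_pairs (A \<inter> B) (A \<inter> B) x"
    by (auto simp: ordered_pairs_def)
  then have union: "card (ordered_pairs A B x \<union> ordered_pairs B A x)
      + card (ordered_pairs (A \<inter> B) (A \<inter> B) x)
      = card (ordered_pairs A B x) + card (ordered_pairs B A x)"
    using card_Un_Int[OF finite_ordered_pairs finite_ordered_pairs] by metis
  have total: "(\<Sum>i = 0..x div 2. num_repr A B (x - 2 * i)) =
      card (ordered_pairs A B x \<union> ordered_pairs B A x)"
    using assms(2,4,7) by (intro sum_num_repr) (auto simp: A_def B_def)
  \<comment> \<open>The claimed formula with every subtracted term moved across, so that it can be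
    proved over the naturals as a linear combination of the preceding counts.\<close>
  have count: "(\<Sum>i = 0..x div 2. num_repr A B (x - 2 * i)) + D (A \<inter> B) (A \<inter> B)
      + card (H A) * card (H B)
      = D B A + D A B + (card (H (A \<inter> B)) + 1 choose 2)"
    using union card_descents_add[OF fin fin, of A B, folded HC]
      card_descents_self[OF fin, of "A \<inter> B"] total
    unfolding D by linarith
  \<comment> \<open>The term \<open>i = 0\<close> is the value to be computed; the others are the
    subtracted earlier values.\<close>
  have "(\<Sum>i = 0..x div 2. num_repr A B (x - 2 * i)) =
      num_repr A B x + (\<Sum>i = 1..x div 2. num_repr A B (x - 2 * i))"
    by (simp add: sum.atLeast_Suc_atMost)
  from count[unfolded this D_def, THEN arg_cong[where f = int], unfolded of_nat_add of_nat_mult of_nat_sum]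
  show ?thesis
    unfolding seq_count_eq_card[OF assms(1)] seq_count_eq_card[OF assms(3)]
      seq_count_eq_card[OF assms(5)] C A_def[symmetric] B_def[symmetric] half diff
      H_def[symmetric]
    by linarith
qed

end
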